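(* Let $c\in\mathbb{R}$ and assume that $m(c)>-\infty$ and that there exists a minimizing sequence $(u_n)\subset H$ for $m(c)$ (i.e. $G(u_n)=c$ for all $n$ and $J(u_n)\to m(c)$) such that: (a) $(u_n)$ is bounded in $H$; (b) if (up to a subsequence) $u_n\rightharpoonup u$ weakly in $H$, then $J(u)\le \liminf_{n\to\infty}J(u_n)$ (liminf along that subsequence) and $G(u)\le c$. Assume in addition that, for such a weak limit $u$: (c) there exists $v\in H$ such that $G(u+v)=c$ and $J(u+v)\le J(u)$. Then $m(c)$ is reached, i.e. there exists $w\in H$ with $G(w)=c$ and $J(w)=m(c)$.
   Context: Let $N,m\ge 1$, let $H$ be a reflexive Banach space of functions on $\mathbb{R}^N$ with values in $\mathbb{R}^m$, and let $J,G$ be (real-valued) functionals defined on $H$ of the form $$J(u)=\int_{\mathbb{R}^N} j(x,u,|\nabla u|)\,dx,\qquad G(u)=\int_{\mathbb{R}^N} g(u)\,dx,$$ where $j(x,s,t)$ and $g(s)$ are real-valued functions defined on $\mathbb{R}^N\times\mathbb{R}^m\times\mathbb{R}$ and $\mathbb{R}^m$ respectively. For $c\in\mathbb{R}$ set $$m(c)=\inf\{J(u):\ u\in H,\ G(u)=c\}.$$ *)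

theory Defs
  imports "HOL-Analysis.Analysis"
begin

definition reflexive_space :: "'h::banach itself \<Rightarrow> bool" where
  "reflexive_space _ \<longleftrightarrow>
     (\<forall>\<Phi> :: ('h \<Rightarrow>\<^sub>L real) \<Rightarrow>\<^sub>L real. \<exists>x :: 'h. \<forall>f :: 'h \<Rightarrow>\<^sub>L real.
        blinfun_apply \<Phi> f = blinfun_apply f x)"

definition weakly_tendsto :: "(nat \<Rightarrow> 'h::banach) \<Rightarrow> 'h \<Rightarrow> bool" where
  "weakly_tendsto us u \<longleftrightarrow>
     (\<forall>f :: 'h \<Rightarrow>\<^sub>L real. (\<lambda>n. blinfun_apply f (us n)) \<longlonglongrightarrow> blinfun_apply f u)"

definition partial_deriv :: "'n \<Rightarrow> (real ^ 'n \<Rightarrow> real) \<Rightarrow> real ^ 'n::finite \<Rightarrow> real" where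
  "partial_deriv i \<phi> x = frechet_derivative \<phi> (at x) (axis i 1)"

fun C_k :: "nat \<Rightarrow> (real ^ 'n::finite \<Rightarrow> real) \<Rightarrow> bool" where
  "C_k 0 \<phi> \<longleftrightarrow> continuous_on UNIV \<phi>"
| "C_k (Suc k) \<phi> \<longleftrightarrow> \<phi> differentiable_on UNIV \<and> (\<forall>i. C_k k (partial_deriv i \<phi>))"

definition test_function :: "(real ^ 'n::finite \<Rightarrow> real) \<Rightarrow> bool" where
  "test_function \<phi> \<longleftrightarrow> (\<forall>k. C_k k \<phi>) \<and> compact (closure {x. \<phi> x \<noteq> 0})"

text \<open>The distributional gradient of a vector-valued function; row \<open>k\<close> of the matrix
  \<open>D x\<close> is the gradient of the \<open>k\<close>-th component.\<close>

definition has_weak_gradient ::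
    "(real ^ 'n::finite \<Rightarrow> real ^ 'm::finite) \<Rightarrow> (real ^ 'n \<Rightarrow> real ^ 'n ^ 'm) \<Rightarrow> bool" where
  "has_weak_gradient u D \<longleftrightarrow>
     (\<forall>K. compact K \<longrightarrow> u absolutely_integrable_on K \<and> D absolutely_integrable_on K) \<and>
     (\<forall>\<phi> k i. test_function \<phi> \<longrightarrow>
        (LINT x|lebesgue. u x $ k * partial_deriv i \<phi> x) =
          - (LINT x|lebesgue. D x $ k $ i * \<phi> x))"

definition weakly_differentiable :: "(real ^ 'n::finite \<Rightarrow> real ^ 'm::finite) \<Rightarrow> bool" where
  "weakly_differentiable u \<longleftrightarrow> (\<exists>D. has_weak_gradient u D)"

text \<open>The weak gradient is unique up to null sets, so the choice of representative does not
  affect the integrals below.\<close>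

definition weak_gradient ::
    "(real ^ 'n::finite \<Rightarrow> real ^ 'm::finite) \<Rightarrow> real ^ 'n \<Rightarrow> real ^ 'n ^ 'm" where
  "weak_gradient u = (SOME D. has_weak_gradient u D)"

text \<open>A Banach space of functions, with functions identified when they agree almost everywhere:
  a Banach space \<open>'h\<close> together with a map \<open>fn\<close> that picks a representative of each element.
  Vector operations and equality in \<open>'h\<close> are those of the functions modulo null sets.
  Weak differentiability gives a meaning to the gradient of every element.\<close>

definition function_space ::
    "('h::banach \<Rightarrow> real ^ 'n::finite \<Rightarrow> real ^ 'm::finite) \<Rightarrow> bool" where
  "function_space fn \<longleftrightarrow>
     (\<forall>u v. AE x in lebesgue. fn (u + v) x = fn u x + fn v x) \<and>
     (\<forall>a u. AE x in lebesgue. fn (a *\<^sub>R u) x = a *\<^sub>R fn u x) \<and>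
     (\<forall>u v. (AE x in lebesgue. fn u x = fn v x) \<longrightarrow> u = v) \<and>
     (\<forall>u. weakly_differentiable (fn u))"

definition J_integrand ::
    "(real ^ 'n \<Rightarrow> real ^ 'm \<Rightarrow> real \<Rightarrow> real) \<Rightarrow> (real ^ 'n::finite \<Rightarrow> real ^ 'm::finite)
      \<Rightarrow> real ^ 'n \<Rightarrow> real" where
  "J_integrand j u x = j x (u x) (norm (weak_gradient u x))"

definition J_functional ::
    "('h \<Rightarrow> real ^ 'n::finite \<Rightarrow> real ^ 'm::finite) \<Rightarrow>
      (real ^ 'n \<Rightarrow> real ^ 'm \<Rightarrow> real \<Rightarrow> real) \<Rightarrow> 'h \<Rightarrow> real" where
  "J_functional fn j u = (LINT x|lebesgue. J_integrand j (fn u) x)"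

definition G_functional ::
    "('h \<Rightarrow> real ^ 'n::finite \<Rightarrow> real ^ 'm::finite) \<Rightarrow> (real ^ 'm \<Rightarrow> real) \<Rightarrow> 'h \<Rightarrow> real" where
  "G_functional fn g u = (LINT x|lebesgue. g (fn u x))"

definition constrained_inf :: "('h \<Rightarrow> real) \<Rightarrow> ('h \<Rightarrow> real) \<Rightarrow> real \<Rightarrow> ereal" where
  "constrained_inf J G c = (INF u\<in>{u. G u = c}. ereal (J u))"

definition minimizing_sequence ::
    "('h \<Rightarrow> real) \<Rightarrow> ('h \<Rightarrow> real) \<Rightarrow> real \<Rightarrow> (nat \<Rightarrow> 'h) \<Rightarrow> bool" where
  "minimizing_sequence J G c us \<longleftrightarrow>
     (\<forall>n. G (us n) = c) \<and> (\<lambda>n. ereal (J (us n))) \<longlonglongrightarrow> constrained_inf J G c"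

end

theory Submission
  imports Defs "HOL-Library.Diagonal_Subsequence"
begin

text \<open>
  The argument is the direct method. A bounded minimizing sequence has a weakly convergent
  subsequence, with limit \<open>u\<close> say; lower semicontinuity gives \<open>J u \<le> m\<close> for the infimum \<open>m\<close>, and the
  corrector \<open>v\<close> moves \<open>u\<close> back onto the constraint set without raising \<open>J\<close>. Thus \<open>u + v\<close> is
  admissible with \<open>J (u + v) \<le> m\<close>, hence a minimizer.

  The analytic content is the weak sequential compactness of bounded sequences in a reflexive
  Banach space (\<open>reflexive_bounded_imp_weakly_convergent_subsequence\<close>). It rests on one form of the
  Hahn--Banach theorem (\<open>Hahn_Banach_sublinear\<close>): every sublinear functional dominates a linear one
  that agrees with it at a prescribed point. This theorem is used three times:

  \<^item> with the norm, for functionals \<open>F d\<close> that norm the points of a countable set dense in the span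
    of the sequence; a diagonal subsequence \<open>vs\<close> makes \<open>F d (vs n)\<close> converge for every \<open>d\<close>;

  \<^item> with the distance to a subspace, to show that weak cluster points stay in the closed span,
    where the \<open>F d\<close> separate points;

  \<^item> on the dual space with the sublinear functional sending \<open>f\<close> to the upper limit of \<open>f (vs n)\<close>,
    where it yields a bidual element that reflexivity turns into a point \<open>x\<close> of the space. This
    \<open>x\<close> behaves like a weak cluster point, and it can be chosen to realize the upper limit of any
    prescribed functional.

  All cluster points agree on the \<open>F d\<close>, so there is only one, and it realizes the upper limits of
  \<open>f\<close> and of \<open>- f\<close> for every \<open>f\<close>. Upper and lower limit therefore coincide: \<open>vs\<close> converges weakly.
\<close>

section \<open>Sublinear functionals and the Hahn--Banach theorem\<close>

text \<open>An inequality suffices in the second clause: applying it to \<open>t\<close> and to \<open>1/t\<close> gives equality.\<close>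

definition sublinear :: "('a::real_vector \<Rightarrow> real) \<Rightarrow> bool" where
  "sublinear p \<longleftrightarrow>
     (\<forall>x y. p (x + y) \<le> p x + p y) \<and> (\<forall>t x. t > 0 \<longrightarrow> p (t *\<^sub>R x) \<le> t * p x)"

lemma sublinearI:
  assumes "\<And>x y. p (x + y) \<le> p x + p y" "\<And>t x. t > 0 \<Longrightarrow> p (t *\<^sub>R x) \<le> t * p x"
  shows "sublinear p"
  using assms by (simp add: sublinear_def)

lemma sublinear_add: "sublinear p \<Longrightarrow> p (x + y) \<le> p x + p y"
  by (simp add: sublinear_def)

lemma sublinear_scale_le: "sublinear p \<Longrightarrow> t > 0 \<Longrightarrow> p (t *\<^sub>R x) \<le> t * p x"
  by (simp add: sublinear_def)

lemma sublinear_zero: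
  assumes "sublinear p"
  shows "p 0 = 0"
  using sublinear_scale_le[OF assms, of 2 0] sublinear_scale_le[OF assms, of "1/2" 0] by simp

lemma sublinear_scale:
  assumes "sublinear p" "t \<ge> 0"
  shows "p (t *\<^sub>R x) = t * p x"
proof (cases "t = 0")
  case True
  then show ?thesis using sublinear_zero[OF assms(1)] by simp
next
  case False
  then have t: "t > 0" using assms(2) by simp
  have "p x \<le> inverse t * p (t *\<^sub>R x)"
    using sublinear_scale_le[OF assms(1), of "inverse t" "t *\<^sub>R x"] t by simp
  then have "t * p x \<le> p (t *\<^sub>R x)" using t by (simp add: field_simps)
  then show ?thesis using sublinear_scale_le[OF assms(1) t, of x] by simp
qed

lemma sublinear_minus_le:
  assumes "sublinear p"
  shows "- p (- x) \<le> p x"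
  using sublinear_add[OF assms, of x "- x"] sublinear_zero[OF assms] by simp

text \<open>Any sublinear \<open>p\<close> can be lowered until it is odd at a given point: take the infimum of
  \<open>p (x + t *\<^sub>R a) - t * p a\<close> over \<open>t \<ge> 0\<close>, where \<open>t = 0\<close> shows that this lies below \<open>p\<close> and \<open>t = 1\<close>
  gives the value at \<open>- a\<close>. The same construction later shows that minimal functionals are linear
  and that a linear minorant can touch \<open>p\<close> at \<open>a\<close>.\<close>

lemma sublinear_reduce:
  assumes p: "sublinear p"
  shows "\<exists>q. sublinear q \<and> (\<forall>x. q x \<le> p x) \<and> q (- a) \<le> - p a"
proof -
  define q where "q x = (INF t\<in>{0..}. p (x + t *\<^sub>R a) - t * p a)" for x
  have lower: "- p (- x) \<le> p (x + t *\<^sub>R a) - t * p a" if "t \<ge> 0" for x t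
    using sublinear_add[OF p, of "x + t *\<^sub>R a" "- x"] sublinear_scale[OF p that, of a] by simp
  have upper: "q x \<le> p (x + t *\<^sub>R a) - t * p a" if "t \<ge> 0" for x t
    unfolding q_def using lower that by (intro cINF_lower bdd_belowI2[where m = "- p (- x)"]) auto
  have greatest: "b \<le> q x" if "\<And>t. t \<ge> 0 \<Longrightarrow> b \<le> p (x + t *\<^sub>R a) - t * p a" for b x
    unfolding q_def using that by (intro cINF_greatest) auto
  have "sublinear q"
  proof (rule sublinearI)
    fix x y
    have *: "q (x + y) \<le> (p (x + s *\<^sub>R a) - s * p a) + (p (y + t *\<^sub>R a) - t * p a)"
      if "s \<ge> 0" "t \<ge> 0" for s t
    proof -
      have "(x + y) + (s + t) *\<^sub>R a = (x + s *\<^sub>R a) + (y + t *\<^sub>R a)"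
        by (simp add: algebra_simps)
      then show ?thesis
        using upper[of "s + t" "x + y"] that sublinear_add[OF p, of "x + s *\<^sub>R a" "y + t *\<^sub>R a"]
        by (simp add: algebra_simps)
    qed
    have "q (x + y) - q y \<le> p (x + s *\<^sub>R a) - s * p a" if "s \<ge> 0" for s
      using greatest[of "q (x + y) - (p (x + s *\<^sub>R a) - s * p a)" y] *[OF that] by force
    then show "q (x + y) \<le> q x + q y" using greatest[of "q (x + y) - q y" x] by force
  next
    fix t :: real and x assume t: "t > 0"
    have "q (t *\<^sub>R x) / t \<le> p (x + s *\<^sub>R a) - s * p a" if "s \<ge> 0" for s
    proof -
      have "q (t *\<^sub>R x) \<le> p (t *\<^sub>R (x + s *\<^sub>R a)) - t * s * p a"
        using upper[of "t * s" "t *\<^sub>R x"] that t by (simp add: algebra_simps)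
      also have "\<dots> = t * (p (x + s *\<^sub>R a) - s * p a)"
        using t sublinear_scale[OF p, of t "x + s *\<^sub>R a"] by (simp add: right_diff_distrib)
      finally show ?thesis using t by (simp add: field_simps)
    qed
    then have "q (t *\<^sub>R x) / t \<le> q x" by (rule greatest)
    then show "q (t *\<^sub>R x) \<le> t * q x" using t by (simp add: field_simps)
  qed
  moreover have "q x \<le> p x" for x using upper[of 0 x] by simp
  moreover have "q (- a) \<le> - p a" using upper[of 1 "- a"] sublinear_zero[OF p] by simp
  ultimately show ?thesis by blast
qed

text \<open>Zorn's lemma for the reversed pointwise order. The pointwise infimum of a chain is finite because
  all members lie above \<open>- p (- x)\<close>; it is subadditive because any two members are
  comparable, and the smaller one bounds both terms.\<close>

lemma minimal_sublinear_exists: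
  assumes p: "sublinear p"
  shows "\<exists>m. sublinear m \<and> (\<forall>x. m x \<le> p x) \<and>
    (\<forall>q. sublinear q \<longrightarrow> (\<forall>x. q x \<le> m x) \<longrightarrow> q = m)"
proof -
  let ?A = "{q. sublinear q \<and> (\<forall>x. q x \<le> p x)}"
  let ?P = "\<lambda>q r. \<forall>x. r x \<le> (q x :: real)"
  have "\<exists>m\<in>?A. \<forall>q\<in>?A. ?P m q \<longrightarrow> q = m"
  proof (rule predicate_Zorn)
    show "partial_order_on ?A (relation_of ?P ?A)"
      proof (rule partial_order_on_relation_ofI)
      show "?P q s" if "?P q r" "?P r s" for q r s :: "'a \<Rightarrow> real"
        using that by (meson order_trans)
      show "q = r" if "?P q r" "?P r q" for q r :: "'a \<Rightarrow> real"
        using that by (intro ext antisym) auto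
    qed auto
  next
    fix C assume C: "C \<in> Chains (relation_of ?P ?A)"
    have CA: "sublinear q" "q x \<le> p x" if "q \<in> C" for q x
      using C that by (auto simp: Chains_def relation_of_def)
    have chain: "?P q r \<or> ?P r q" if "q \<in> C" "r \<in> C" for q r
      using C that by (auto simp: Chains_def relation_of_def)
    show "\<exists>u\<in>?A. \<forall>q\<in>C. ?P q u"
    proof (cases "C = {}")
      case True
      then show ?thesis using p by blast
    next
      case False
      define u where "u x = (INF q\<in>C. q x)" for x
      have "- p (- x) \<le> q x" if "q \<in> C" for q x
        using sublinear_minus_le[OF CA(1)[OF that], of x] CA(2)[OF that, of "- x"] by linarith
      then have lower: "u x \<le> q x" if "q \<in> C" for q x
        unfolding u_def using that by (intro cINF_lower bdd_belowI2[where m = "- p (- x)"]) auto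
      have greatest: "b \<le> u x" if "\<And>q. q \<in> C \<Longrightarrow> b \<le> q x" for b x
        unfolding u_def using that False by (intro cINF_greatest) auto
      have "sublinear u"
      proof (rule sublinearI)
        fix x y
        have *: "u (x + y) \<le> q x + r y" if "q \<in> C" "r \<in> C" for q r
          using chain[OF that]
        proof
          assume "?P q r"
          then show ?thesis
            using lower[OF that(2), of "x + y"] sublinear_add[OF CA(1)[OF that(2)], of x y]
            by (smt (verit))
        next
          assume "?P r q"
          then show ?thesis
            using lower[OF that(1), of "x + y"] sublinear_add[OF CA(1)[OF that(1)], of x y]
            by (smt (verit))
        qed
        have "u (x + y) - u y \<le> q x" if "q \<in> C" for q
          using greatest[of "u (x + y) - q x" y] *[OF that] by force
        then show "u (x + y) \<le> u x + u y" using greatest[of "u (x + y) - u y" x] by force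
      next
        fix t :: real and x assume t: "t > 0"
        have "u (t *\<^sub>R x) / t \<le> q x" if "q \<in> C" for q
        proof -
          have "u (t *\<^sub>R x) \<le> t * q x"
            using lower[OF that, of "t *\<^sub>R x"] sublinear_scale_le[OF CA(1)[OF that] t, of x]
            by linarith
          then show ?thesis using t by (simp add: field_simps)
        qed
        then have "u (t *\<^sub>R x) / t \<le> u x" by (rule greatest)
        then show "u (t *\<^sub>R x) \<le> t * u x" using t by (simp add: field_simps)
      qed
      moreover have "u x \<le> p x" for x
        using False lower CA(2) by (metis all_not_in_conv order_trans)
      ultimately show ?thesis using lower by blast
    qed
  qed
  then obtain m where "m \<in> ?A" and min: "\<And>q. q \<in> ?A \<Longrightarrow> ?P m q \<Longrightarrow> q = m" by blast
  then have m: "sublinear m" "\<And>x. m x \<le> p x" by auto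
  have "q = m" if "sublinear q" "\<forall>x. q x \<le> m x" for q
    using that m(2) by (intro min) (auto intro: order_trans)
  with m show ?thesis by blast
qed

text \<open>Minimality forbids a proper reduction, so \<open>m\<close> is odd at every point, and an odd sublinear
  functional is linear.\<close>

lemma minimal_sublinear_linear:
  assumes m: "sublinear m" and min: "\<And>q. sublinear q \<Longrightarrow> (\<And>x. q x \<le> m x) \<Longrightarrow> q = m"
  shows "linear m"
proof -
  have odd: "m (- x) = - m x" for x
  proof (rule antisym)
    show "m (- x) \<le> - m x" using sublinear_reduce[OF m, of x] min by metis
    show "- m x \<le> m (- x)" using sublinear_minus_le[OF m, of "- x"] by simp
  qed
  show ?thesis
  proof (rule linearI)
    fix x y
    have "m (- x + - y) \<le> m (- x) + m (- y)" by (rule sublinear_add[OF m])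
    then have "m x + m y \<le> m (x + y)" using odd[of "x + y"] odd[of x] odd[of y] by simp
    then show "m (x + y) = m x + m y" using sublinear_add[OF m, of x y] by simp
  next
    fix t x
    show "m (t *\<^sub>R x) = t *\<^sub>R m x"
    proof (cases "t \<ge> 0")
      case True
      then show ?thesis by (simp add: sublinear_scale[OF m])
    next
      case False
      then have "m (t *\<^sub>R x) = - m ((- t) *\<^sub>R x)" using odd[of "(- t) *\<^sub>R x"] by simp
      also have "\<dots> = t * m x" using False sublinear_scale[OF m, of "- t" x] by simp
      finally show ?thesis by simp
    qed
  qed
qed

text \<open>The prescribed value at \<open>a\<close> costs only one reduction before the minimal functional is chosen:
  once \<open>q (- a) \<le> - p a\<close>, every linear functional below \<open>q\<close> is at least \<open>p a\<close> at \<open>a\<close>.\<close>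

theorem Hahn_Banach_sublinear:
  assumes p: "sublinear p"
  shows "\<exists>f. linear f \<and> (\<forall>x. f x \<le> p x) \<and> f a = p a"
proof -
  obtain q where q: "sublinear q" "\<And>x. q x \<le> p x" "q (- a) \<le> - p a"
    using sublinear_reduce[OF p] by blast
  obtain f where f: "sublinear f" "\<And>x. f x \<le> q x"
      "\<And>r. sublinear r \<Longrightarrow> (\<And>x. r x \<le> f x) \<Longrightarrow> r = f"
    using minimal_sublinear_exists[OF q(1)] by blast
  have lin: "linear f" by (rule minimal_sublinear_linear[OF f(1,3)])
  have le: "f x \<le> p x" for x using f(2)[of x] q(2)[of x] by simp
  have "f (- a) \<le> - p a" using f(2)[of "- a"] q(3) by simp
  then have "p a \<le> f a" using linear_neg[OF lin, of a] by simp
  then show ?thesis using lin le antisym by metis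
qed

corollary Hahn_Banach_bounded:
  fixes p :: "'a::real_normed_vector \<Rightarrow> real"
  assumes p: "sublinear p" and bound: "\<And>x. p x \<le> K * norm x"
  shows "\<exists>f :: 'a \<Rightarrow>\<^sub>L real. (\<forall>x. f x \<le> p x) \<and> f a = p a"
proof -
  obtain f where f: "linear f" "\<And>x. f x \<le> p x" "f a = p a"
    using Hahn_Banach_sublinear[OF p] by blast
  have "\<bar>f x\<bar> \<le> norm x * K" for x
    using f(2)[of x] f(2)[of "- x"] bound[of x] bound[of "- x"] linear_neg[OF f(1), of x]
    by (simp add: abs_le_iff mult.commute)
  then have "bounded_linear f"
    using f(1) by (intro bounded_linear_intro[where K = K]) (auto simp: linear_add linear_scale)
  then show ?thesis using f by (intro exI[of _ "Blinfun f"]) (simp add: bounded_linear_Blinfun_apply)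
qed

corollary norming_functional:
  fixes a :: "'a::real_normed_vector"
  shows "\<exists>f :: 'a \<Rightarrow>\<^sub>L real. (\<forall>x. \<bar>f x\<bar> \<le> norm x) \<and> f a = norm a"
proof -
  have "sublinear (norm :: 'a \<Rightarrow> real)"
    by (rule sublinearI) (auto simp: norm_triangle_ineq)
  from Hahn_Banach_bounded[OF this, of 1 a]
  obtain f :: "'a \<Rightarrow>\<^sub>L real" where f: "\<And>x. f x \<le> norm x" "f a = norm a" by auto
  have "\<bar>f x\<bar> \<le> norm x" for x
    using f(1)[of x] f(1)[of "- x"] by (simp add: abs_le_iff blinfun.minus_right)
  then show ?thesis using f(2) by blast
qed

lemma sublinear_infdist:
  fixes M :: "'a::real_normed_vector set"
  assumes M: "subspace M"
  shows "sublinear (\<lambda>x. infdist x M)"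
proof -
  have ne: "M \<noteq> {}" using subspace_0[OF M] by auto
  have near: "\<exists>m\<in>M. dist x m < infdist x M + e" if "e > 0" for x e
    using cInf_lessD[of "dist x ` M" "infdist x M + e"] ne that
    by (auto simp: infdist_notempty)
  show ?thesis
  proof (rule sublinearI)
    fix x y
    show "infdist (x + y) M \<le> infdist x M + infdist y M"
    proof (rule field_le_epsilon)
      fix e :: real assume "e > 0"
      then obtain m n where mn: "m \<in> M" "dist x m < infdist x M + e/2"
          "n \<in> M" "dist y n < infdist y M + e/2"
        using near[of "e/2" x] near[of "e/2" y] by auto
      have "infdist (x + y) M \<le> dist (x + y) (m + n)"
        using mn subspace_add[OF M] by (intro infdist_le)
      also have "\<dots> \<le> dist x m + dist y n" by (rule dist_triangle_add)
      finally show "infdist (x + y) M \<le> infdist x M + infdist y M + e" using mn by simp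
    qed
  next
    fix t :: real and x assume t: "t > 0"
    show "infdist (t *\<^sub>R x) M \<le> t * infdist x M"
    proof (rule field_le_epsilon)
      fix e :: real assume "e > 0"
      then obtain m where m: "m \<in> M" "dist x m < infdist x M + e / t"
        using near[of "e / t" x] t by auto
      have "infdist (t *\<^sub>R x) M \<le> dist (t *\<^sub>R x) (t *\<^sub>R m)"
        using m subspace_scale[OF M] by (intro infdist_le)
      also have "\<dots> = t * dist x m" using t by (simp add: dist_norm flip: scaleR_diff_right)
      also have "\<dots> \<le> t * (infdist x M + e / t)" using m t by (intro mult_left_mono) auto
      finally show "infdist (t *\<^sub>R x) M \<le> t * infdist x M + e" using t by (simp add: distrib_left)
    qed
  qed
qed

text \<open>Continuous functionals detect the closure of a subspace: a functional dominated by the distance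
  to \<open>M\<close> vanishes on \<open>M\<close>, and it can be chosen to equal that distance at \<open>x\<close>.\<close>

corollary in_closure_subspace:
  fixes M :: "'a::real_normed_vector set"
  assumes M: "subspace M" and x: "\<And>f :: 'a \<Rightarrow>\<^sub>L real. (\<And>m. m \<in> M \<Longrightarrow> f m = 0) \<Longrightarrow> f x = 0"
  shows "x \<in> closure M"
proof -
  have "infdist y M \<le> 1 * norm y" for y
    using infdist_le[OF subspace_0[OF M], of y] by simp
  from Hahn_Banach_bounded[OF sublinear_infdist[OF M] this]
  obtain f :: "'a \<Rightarrow>\<^sub>L real" where f: "\<And>y. f y \<le> infdist y M" "f x = infdist x M" by blast
  have "f m = 0" if "m \<in> M" for m
    using f(1)[of m] f(1)[of "- m"] that subspace_neg[OF M that] by (simp add: blinfun.minus_right)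
  then have "infdist x M = 0" using x f(2) by metis
  then show ?thesis using in_closure_iff_infdist_zero[of M x] subspace_0[OF M] by auto
qed

section \<open>Upper limits of bounded real sequences\<close>

text \<open>This is the limit superior of a bounded sequence. \<open>Limsup\<close> lives in a complete lattice, and the
  infimum of the eventual upper bounds keeps the values in \<open>real\<close>, as needed for a sublinear
  functional.\<close>

definition upper_limit :: "(nat \<Rightarrow> real) \<Rightarrow> real" where
  "upper_limit s = Inf {b. \<forall>\<^sub>F n in sequentially. s n \<le> b}"

lemma upper_limit_le:
  assumes "bounded (range s)" "\<forall>\<^sub>F n in sequentially. s n \<le> b"
  shows "upper_limit s \<le> b"
proof -
  obtain C where C: "\<And>n. \<bar>s n\<bar> \<le> C" using assms(1) by (auto simp: bounded_iff)
  have "- C \<le> y" if y: "\<forall>\<^sub>F n in sequentially. s n \<le> y" for y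
  proof -
    obtain n where "s n \<le> y" using y unfolding eventually_sequentially by blast
    then show ?thesis using C[of n] by linarith
  qed
  then show ?thesis
    unfolding upper_limit_def using assms(2) by (intro cInf_lower bdd_belowI[where m = "- C"]) auto
qed

lemma eventually_le_upper_limit:
  assumes "bounded (range s)" "upper_limit s < b"
  shows "\<forall>\<^sub>F n in sequentially. s n \<le> b"
proof -
  obtain C where C: "\<And>n. \<bar>s n\<bar> \<le> C" using assms(1) by (auto simp: bounded_iff)
  have "C \<in> {b. \<forall>\<^sub>F n in sequentially. s n \<le> b}"
    using C by (auto intro!: always_eventually simp: abs_le_iff)
  then obtain y where "\<forall>\<^sub>F n in sequentially. s n \<le> y" "y < b"
    using cInf_lessD[of "{b. \<forall>\<^sub>F n in sequentially. s n \<le> b}" b] assms(2)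
    unfolding upper_limit_def by blast
  then show ?thesis by (auto elim: eventually_mono)
qed

lemma upper_limit_eq_lim:
  assumes "s \<longlonglongrightarrow> l"
  shows "upper_limit s = l"
proof (rule antisym)
  have b: "bounded (range s)" using assms by (rule convergent_imp_bounded)
  show "upper_limit s \<le> l"
  proof (rule field_le_epsilon)
    fix e :: real assume "e > 0"
    then have "\<forall>\<^sub>F n in sequentially. s n \<le> l + e"
      using order_tendstoD(2)[OF assms, of "l + e"] by (auto elim: eventually_mono)
    then show "upper_limit s \<le> l + e" by (rule upper_limit_le[OF b])
  qed
  show "l \<le> upper_limit s"
  proof (rule field_le_epsilon)
    fix e :: real assume "e > 0"
    then have "\<forall>\<^sub>F n in sequentially. s n \<le> upper_limit s + e"
      by (intro eventually_le_upper_limit[OF b]) simp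
    then show "l \<le> upper_limit s + e" by (intro tendsto_upperbound[OF assms]) auto
  qed
qed

lemma tendsto_of_upper_limits:
  assumes b: "bounded (range s)" and "upper_limit s \<le> l" "upper_limit (\<lambda>n. - s n) \<le> - l"
  shows "s \<longlonglongrightarrow> l"
proof (rule order_tendstoI)
  have b': "bounded (range (\<lambda>n. - s n))" using b by (auto simp: bounded_iff)
  fix y
  { assume y: "y < l"
    then have "\<forall>\<^sub>F n in sequentially. - s n \<le> (- y - l) / 2"
      using assms(3) by (intro eventually_le_upper_limit[OF b']) (simp add: field_simps)
    then show "\<forall>\<^sub>F n in sequentially. y < s n"
      by (rule eventually_mono) (use y in \<open>simp add: field_simps\<close>) }
  { assume y: "l < y"
    then have "\<forall>\<^sub>F n in sequentially. s n \<le> (y + l) / 2"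
      using assms(2) by (intro eventually_le_upper_limit[OF b]) simp
    then show "\<forall>\<^sub>F n in sequentially. s n < y"
      by (rule eventually_mono) (use y in \<open>simp add: field_simps\<close>) }
qed

section \<open>Weak cluster points in a reflexive space\<close>

lemma bounded_range_functional:
  fixes f :: "'a::real_normed_vector \<Rightarrow>\<^sub>L real"
  assumes "bounded (range vs)"
  shows "bounded (range (\<lambda>n. f (vs n)))"
  using bounded_linear_image[OF assms blinfun.bounded_linear_right[of f]] by (simp add: image_image)

lemma sublinear_upper_limit:
  fixes vs :: "nat \<Rightarrow> 'a::real_normed_vector"
  assumes bdd: "bounded (range vs)"
  shows "sublinear (\<lambda>f :: 'a \<Rightarrow>\<^sub>L real. upper_limit (\<lambda>n. f (vs n)))"
proof (rule sublinearI)
  note b = bounded_range_functional[OF bdd]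
  have ev: "\<forall>\<^sub>F n in sequentially. f (vs n) \<le> upper_limit (\<lambda>n. f (vs n)) + e"
    if "e > 0" for f :: "'a \<Rightarrow>\<^sub>L real" and e
    using that by (intro eventually_le_upper_limit[OF b]) simp
  fix f g :: "'a \<Rightarrow>\<^sub>L real"
  let ?F = "upper_limit (\<lambda>n. f (vs n))" and ?G = "upper_limit (\<lambda>n. g (vs n))"
  show "upper_limit (\<lambda>n. (f + g) (vs n)) \<le> ?F + ?G"
  proof (rule field_le_epsilon)
    fix e :: real assume "e > 0"
    then have "\<forall>\<^sub>F n in sequentially. (f + g) (vs n) \<le> ?F + ?G + e"
      using eventually_conj[OF ev[of "e/2" f] ev[of "e/2" g]]
      by (auto elim!: eventually_mono simp: blinfun.add_left)
    then show "upper_limit (\<lambda>n. (f + g) (vs n)) \<le> ?F + ?G + e" by (rule upper_limit_le[OF b])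
  qed
  fix t :: real assume t: "t > 0"
  show "upper_limit (\<lambda>n. (t *\<^sub>R f) (vs n)) \<le> t * ?F"
  proof (rule field_le_epsilon)
    fix e :: real assume e: "e > 0"
    have "t * f x \<le> t * ?F + e" if "f x \<le> ?F + e / t" for x
      using mult_left_mono[OF that, of t] t by (simp add: distrib_left)
    then have "\<forall>\<^sub>F n in sequentially. (t *\<^sub>R f) (vs n) \<le> t * ?F + e"
      using ev[of "e / t" f] t e by (auto elim!: eventually_mono simp: blinfun.scaleR_left)
    then show "upper_limit (\<lambda>n. (t *\<^sub>R f) (vs n)) \<le> t * ?F + e" by (rule upper_limit_le[OF b])
  qed
qed

text \<open>A linear functional on the dual below the upper limit functional plays the part of a limit along
  an ultrafilter: it is bounded because the sequence is, so reflexivity represents it by a point \<open>x\<close>.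
  Since \<open>g\<close> is arbitrary, uniqueness of such a point forces weak convergence.\<close>

lemma weak_cluster_point:
  fixes vs :: "nat \<Rightarrow> 'h::banach" and g :: "'h \<Rightarrow>\<^sub>L real"
  assumes refl: "reflexive_space TYPE('h)" and bdd: "bounded (range vs)"
  shows "\<exists>x. (\<forall>f :: 'h \<Rightarrow>\<^sub>L real. f x \<le> upper_limit (\<lambda>n. f (vs n))) \<and>
    g x = upper_limit (\<lambda>n. g (vs n))"
proof -
  obtain C where C: "\<And>n. norm (vs n) \<le> C" using bdd by (auto simp: bounded_iff)
  have bound: "upper_limit (\<lambda>n. f (vs n)) \<le> C * norm f" for f :: "'h \<Rightarrow>\<^sub>L real"
  proof -
    have "f (vs n) \<le> C * norm f" for n
    proof -
      have "f (vs n) \<le> norm (f (vs n))" by simp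
      also have "\<dots> \<le> norm f * norm (vs n)" by (rule norm_blinfun)
      also have "\<dots> \<le> norm f * C" using C by (intro mult_left_mono) auto
      finally show ?thesis by (simp add: mult.commute)
    qed
    then show ?thesis by (intro upper_limit_le bounded_range_functional[OF bdd] always_eventually) auto
  qed
  from Hahn_Banach_bounded[OF sublinear_upper_limit[OF bdd] bound, of g]
  obtain \<Phi> :: "('h \<Rightarrow>\<^sub>L real) \<Rightarrow>\<^sub>L real" where
    \<Phi>: "\<And>f. \<Phi> f \<le> upper_limit (\<lambda>n. f (vs n))" "\<Phi> g = upper_limit (\<lambda>n. g (vs n))"
    by blast
  obtain x where "\<And>f. \<Phi> f = blinfun_apply f x"
    using refl unfolding reflexive_space_def by blast
  then show ?thesis using \<Phi> by metis
qed

section \<open>Bounded sequences have weakly convergent subsequences\<close>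

text \<open>The dense set consists of the rational combinations. Indexing them by lists of coefficient-vector
  pairs makes prepending a pair match the induction over the span.\<close>

lemma countable_dense_in_span:
  fixes S :: "'a::real_normed_vector set"
  assumes "countable S"
  shows "\<exists>D. countable D \<and> span S \<subseteq> closure D"
proof -
  define comb where "comb l = (\<Sum>(q, s)\<leftarrow>l. real_of_rat q *\<^sub>R s)" for l :: "(rat \<times> 'a) list"
  define D where "D = comb ` lists (UNIV \<times> S)"
  have "countable D"
    unfolding D_def using assms by (intro countable_image countable_lists countable_SIGMA) auto
  moreover have "x \<in> closure D" if "x \<in> span S" for x
    using that
  proof (induction rule: span_induct_alt)
    case base
    have "0 = comb []" by (simp add: comb_def)
    then have "0 \<in> D" unfolding D_def by blast
    then show ?case using closure_subset by blast
  next
    case (step c s y)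
    show ?case unfolding closure_approachable
    proof (intro allI impI)
      fix e :: real assume e: "e > 0"
      obtain l where l: "l \<in> lists (UNIV \<times> S)" "dist (comb l) y < e/2"
        using step(2) half_gt_zero[OF e] unfolding closure_approachable D_def by blast
      \<comment> \<open>The summand 1 keeps the denominator positive when \<open>s = 0\<close>.\<close>
      define \<delta> where "\<delta> = e / (2 * (norm s + 1))"
      have \<delta>: "\<delta> > 0" using e by (simp add: \<delta>_def add_nonneg_pos)
      obtain q where q: "c < real_of_rat q" "real_of_rat q < c + \<delta>"
        using of_rat_dense[of c "c + \<delta>"] \<delta> by auto
      have "dist (real_of_rat q *\<^sub>R s) (c *\<^sub>R s) = \<bar>real_of_rat q - c\<bar> * norm s"
        by (simp add: dist_norm flip: scaleR_diff_left)
      also have "\<dots> \<le> \<delta> * (norm s + 1)" using q by (intro mult_mono) auto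
      also have "\<dots> = e/2"
      proof -
        have "norm s + 1 > 0" by (simp add: add_nonneg_pos)
        then show ?thesis unfolding \<delta>_def by (simp add: divide_simps)
      qed
      finally have "dist (comb ((q, s) # l)) (c *\<^sub>R s + y) < e"
        using l(2) dist_triangle_add[of "real_of_rat q *\<^sub>R s" "comb l" "c *\<^sub>R s" y]
        by (simp add: comb_def)
      moreover have "comb ((q, s) # l) \<in> D" unfolding D_def using l(1) step(1) by auto
      ultimately show "\<exists>z\<in>D. dist z (c *\<^sub>R s + y) < e" by blast
    qed
  qed
  ultimately show ?thesis by blast
qed

lemma diagonal_convergent_subsequence:
  fixes s :: "nat \<Rightarrow> nat \<Rightarrow> real"
  assumes "\<And>k. bounded (range (s k))"
  shows "\<exists>r. strict_mono r \<and> (\<forall>k. convergent (s k \<circ> r))"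
proof -
  interpret subseqs "\<lambda>k r. convergent (s k \<circ> r)"
  proof
    fix k and r :: "nat \<Rightarrow> nat"
    have "bounded (range (s k \<circ> r))" using assms[of k] by (rule bounded_subset) auto
    then obtain l r' where "strict_mono r'" "((s k \<circ> r) \<circ> r') \<longlonglongrightarrow> l"
      using bounded_imp_convergent_subsequence by blast
    then show "\<exists>r'. strict_mono r' \<and> convergent (s k \<circ> (r \<circ> r'))"
      by (auto simp: convergent_def comp_assoc)
  qed
  have "convergent (s k \<circ> diagseq)" for k
  proof -
    have "convergent (s k \<circ> (diagseq \<circ> (+) (Suc k)))"
      by (rule diagseq_holds) (auto simp flip: comp_assoc intro: convergent_subseq_convergent)
    then have "convergent (\<lambda>n. (s k \<circ> diagseq) (n + Suc k))" by (simp add: o_def add.commute)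
    then show ?thesis using convergent_ignore_initial_segment by blast
  qed
  then show ?thesis using subseq_diagseq by blast
qed

text \<open>If all \<open>F d\<close> vanish at \<open>x\<close>, then any \<open>d\<close> near \<open>x\<close> has norm \<open>F d (d - x)\<close>, which is small; so \<open>x\<close>
  itself is arbitrarily small.\<close>

lemma norming_family_separates:
  fixes x :: "'a::real_normed_vector"
  assumes "x \<in> closure D" and F: "\<And>d y. d \<in> D \<Longrightarrow> \<bar>F d y\<bar> \<le> norm y" "\<And>d. d \<in> D \<Longrightarrow> F d d = norm d"
    and "\<And>d. linear (F d)"
    and zero: "\<And>d. d \<in> D \<Longrightarrow> F d x = 0"
  shows "x = 0"
proof -
  have "norm x \<le> 0 + e" if e: "e > 0" for e
  proof -
    obtain d where d: "d \<in> D" "dist d x < e/2"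
      using assms(1) half_gt_zero[OF e] unfolding closure_approachable by blast
    have "norm d = F d (d - x)" using F(2) zero d(1) linear_diff[OF assms(4)] by simp
    also have "\<dots> \<le> dist d x" using F(1)[OF d(1), of "d - x"] by (simp add: dist_norm)
    finally have "norm d \<le> dist d x" .
    moreover have "norm x \<le> norm d + dist d x"
      using norm_triangle_ineq2[of x d] by (simp add: dist_norm norm_minus_commute)
    ultimately show ?thesis using d(2) by linarith
  qed
  then have "norm x \<le> 0" by (rule field_le_epsilon)
  then show ?thesis by simp
qed

text \<open>A cluster point here is an \<open>x\<close> with \<open>f x\<close> at most the upper limit of \<open>f (vs n)\<close> for all \<open>f\<close>. Applied
  to \<open>- f\<close> as well, this forces \<open>f x\<close> to be the limit whenever \<open>f (vs n)\<close> converges. The diagonal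
  subsequence is chosen so that this happens for enough \<open>f\<close> to determine \<open>x\<close>.\<close>

theorem reflexive_bounded_imp_weakly_convergent_subsequence:
  fixes us :: "nat \<Rightarrow> 'h::banach"
  assumes refl: "reflexive_space TYPE('h)" and bdd: "bounded (range us)"
  shows "\<exists>r u. strict_mono r \<and> weakly_tendsto (us \<circ> r) u"
proof -
  define M where "M = span (range us)"
  have M: "subspace M" by (simp add: M_def)
  obtain D where D: "countable D" "M \<subseteq> closure D"
    using countable_dense_in_span[of "range us"] by (auto simp: M_def)
  have "0 \<in> closure D" using D(2) subspace_0[OF M] by blast
  then have D0: "D \<noteq> {}" by auto
  have "\<exists>F :: 'h \<Rightarrow> ('h \<Rightarrow>\<^sub>L real). \<forall>d. (\<forall>x. \<bar>F d x\<bar> \<le> norm x) \<and> F d d = norm d"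
    using norming_functional by (intro choice) blast
  then obtain F :: "'h \<Rightarrow> ('h \<Rightarrow>\<^sub>L real)"
    where F: "\<And>d x. \<bar>F d x\<bar> \<le> norm x" "\<And>d. F d d = norm d" by blast
  obtain r where r: "strict_mono r"
    and conv: "\<And>k. convergent ((\<lambda>n. F (from_nat_into D k) (us n)) \<circ> r)"
    using diagonal_convergent_subsequence[of "\<lambda>k n. F (from_nat_into D k) (us n)"]
      bounded_range_functional[OF bdd] by blast
  define vs where "vs = us \<circ> r"
  have bv: "bounded (range vs)" using bdd unfolding vs_def by (rule bounded_subset) auto
  note bf = bounded_range_functional[OF bv]
  define cluster where
    "cluster x \<longleftrightarrow> (\<forall>f :: 'h \<Rightarrow>\<^sub>L real. f x \<le> upper_limit (\<lambda>n. f (vs n)))" for x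
  have lim: "f x = l" if "cluster x" "(\<lambda>n. f (vs n)) \<longlonglongrightarrow> l" for f :: "'h \<Rightarrow>\<^sub>L real" and x l
  proof -
    have "f x \<le> l" using that upper_limit_eq_lim unfolding cluster_def by metis
    moreover have "(\<lambda>n. (- f) (vs n)) \<longlonglongrightarrow> - l"
      using tendsto_minus[OF that(2)] by (simp add: blinfun.minus_left)
    then have "(- f) x \<le> - l" using that(1) upper_limit_eq_lim unfolding cluster_def by metis
    ultimately show ?thesis by (simp add: blinfun.minus_left)
  qed
  have ann: "f x = 0" if "cluster x" "\<And>m. m \<in> M \<Longrightarrow> f m = 0" for f :: "'h \<Rightarrow>\<^sub>L real" and x
  proof -
    have "f (vs n) = 0" for n using that(2) by (simp add: M_def vs_def span_base)
    then show ?thesis by (intro lim[OF that(1)]) simp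
  qed
  have unique: "x = y" if "cluster x" "cluster y" for x y
  proof -
    have "x - y \<in> closure M"
      by (rule in_closure_subspace[OF M]) (simp add: blinfun.diff_right ann that)
    then have "x - y \<in> closure D" using closure_minimal[OF D(2) closed_closure] by blast
    moreover have "F d (x - y) = 0" if d: "d \<in> D" for d
    proof -
      obtain k where "d = from_nat_into D k" using from_nat_into_surj[OF D(1) d] by metis
      then obtain l where "(\<lambda>n. F d (vs n)) \<longlonglongrightarrow> l"
        using conv[of k] by (auto simp: convergent_def vs_def o_def)
      then have "F d x = F d y" using lim \<open>cluster x\<close> \<open>cluster y\<close> by metis
      then show ?thesis by (simp add: blinfun.diff_right)
    qed
    moreover have "linear (blinfun_apply (F d))" for d
      by (simp add: blinfun.bounded_linear_right bounded_linear.linear)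
    ultimately have "x - y = 0"
      by (intro norming_family_separates[of _ D "\<lambda>d. blinfun_apply (F d)"]) (auto simp: F)
    then show ?thesis by simp
  qed
  \<comment> \<open>Cluster points realizing different upper limits must coincide, so \<open>u\<close> realizes all of them.\<close>
  have attain: "\<exists>x. cluster x \<and> g x = upper_limit (\<lambda>n. g (vs n))" for g :: "'h \<Rightarrow>\<^sub>L real"
    using weak_cluster_point[OF refl bv, of g] unfolding cluster_def .
  then obtain u where u: "cluster u" by blast
  have val: "upper_limit (\<lambda>n. g (vs n)) = g u" for g :: "'h \<Rightarrow>\<^sub>L real"
    using attain[of g] unique[OF u] by metis
  have "(\<lambda>n. f (vs n)) \<longlonglongrightarrow> f u" for f :: "'h \<Rightarrow>\<^sub>L real"
    using val[of f] val[of "- f"]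
    by (intro tendsto_of_upper_limits[OF bf]) (auto simp: blinfun.minus_left)
  then have "weakly_tendsto vs u" unfolding weakly_tendsto_def by blast
  then show ?thesis using r unfolding vs_def by blast
qed

section \<open>Attainment of the constrained infimum\<close>

theorem proposition1p1:
  fixes fn :: "'h::banach \<Rightarrow> real ^ 'n::finite \<Rightarrow> real ^ 'm::finite"
    and j :: "real ^ 'n \<Rightarrow> real ^ 'm \<Rightarrow> real \<Rightarrow> real"
    and g :: "real ^ 'm \<Rightarrow> real"
    and J G :: "'h \<Rightarrow> real"
    and c :: real
    and us :: "nat \<Rightarrow> 'h"
  assumes "reflexive_space TYPE('h)"
    and "function_space fn"
    and "\<And>u. integrable lebesgue (J_integrand j (fn u))"
    and "\<And>u. integrable lebesgue (\<lambda>x. g (fn u x))"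
    and "J = J_functional fn j"
    and "G = G_functional fn g"
    and "constrained_inf J G c > -\<infinity>"
    and "minimizing_sequence J G c us"
    and a: "bounded (range us)"
    and b: "\<And>r u. strict_mono r \<Longrightarrow> weakly_tendsto (us \<circ> r) u \<Longrightarrow>
              ereal (J u) \<le> liminf (\<lambda>n. ereal (J (us (r n)))) \<and> G u \<le> c"
    and c: "\<And>r u. strict_mono r \<Longrightarrow> weakly_tendsto (us \<circ> r) u \<Longrightarrow>
              \<exists>v. G (u + v) = c \<and> J (u + v) \<le> J u"
  shows "\<exists>w. G w = c \<and> ereal (J w) = constrained_inf J G c"
proof -
  obtain r u where r: "strict_mono r" and u: "weakly_tendsto (us \<circ> r) u"
    using reflexive_bounded_imp_weakly_convergent_subsequence[OF assms(1) a] by blast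
  obtain v where v: "G (u + v) = c" "J (u + v) \<le> J u" using c[OF r u] by blast
  have "(\<lambda>n. ereal (J (us n))) \<longlonglongrightarrow> constrained_inf J G c"
    using assms(8) by (simp add: minimizing_sequence_def)
  from LIMSEQ_subseq_LIMSEQ[OF this r]
  have "liminf (\<lambda>n. ereal (J (us (r n)))) = constrained_inf J G c"
    by (intro lim_imp_Liminf) (auto simp: o_def)
  then have "ereal (J u) \<le> constrained_inf J G c" using b[OF r u] by simp
  then have "ereal (J (u + v)) \<le> constrained_inf J G c"
    using v(2) by (meson ereal_less_eq(3) order_trans)
  moreover have "constrained_inf J G c \<le> ereal (J (u + v))"
    unfolding constrained_inf_def using v(1) by (intro INF_lower) simp
  ultimately show ?thesis using v(1) by (intro exI[of _ "u + v"]) (auto intro: antisym)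
qed

end
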